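(* Let $n \geq 1$ and let $\lambda \in \mathbb{C}$ with $|\lambda| < 1$. Then there exist non-inner point derivations at $\varphi_{\lambda}: \mathcal{T}^{+}(\mathcal{C}_n) \rightarrow M_n$; that is, there is a point derivation $D : \mathcal{T}^{+}(\mathcal{C}_n) \to M_n$ at $\varphi_\lambda$ which is not inner at $\varphi_\lambda$.
   Context: $A(\mathbb{D})$ is the disk algebra: functions holomorphic on the open unit disk $\mathbb{D}$ and continuous on $\overline{\mathbb{D}}$, with the supremum norm. For $1 \leq i,j \leq n$ let $\ell(i,j) \in \{0,1,\dots,n-1\}$ be the residue of $j-i$ modulo $n$. The algebra $\mathcal{T}^{+}(\mathcal{C}_n)$ is the subalgebra of $M_n \otimes A(\mathbb{D}) = M_n(A(\mathbb{D}))$ consisting of all matrices $[z^{\ell(i,j)} f_{i,j}(z^n)]_{i,j=1}^n$ with $f_{i,j} \in A(\mathbb{D})$ for all $i,j$, with the norm inherited from $M_n \otimes A(\mathbb{D})$ (the supremum over $z \in \overline{\mathbb{D}}$ of the operator norm of the matrix at $z$). For $\lambda \in \overline{\mathbb{D}}$, the representation $\varphi_{\lambda}: \mathcal{T}^{+}(\mathcal{C}_n) \to M_n$ is defined by $\varphi_{\lambda}([z^{\ell(i,j)} f_{i,j}(z^n)]) = [\lambda^{\ell(i,j)} f_{i,j}(\lambda^n)]$ (with $0^0=1$). For a representation $\pi: A \to B(\mathcal{H})$ of an operator algebra $A$ (a continuous representation by operators on a Hilbert space $\mathcal{H}$), a point derivation at $\pi$ (or derivation at $\pi$) is a continuous linear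 map $D: A \to B(\mathcal{H})$ with $D(ab) = D(a)\pi(b) + \pi(a)D(b)$ for all $a,b \in A$. It is inner at $\pi$ if there is $X \in B(\mathcal{H})$ such that $D(a) = \pi(a)X - X\pi(a)$ for all $a \in A$. Here $\mathcal{H} = \mathbb{C}^n$ and $B(\mathcal{H}) = M_n$. *)

theory Defs
  imports "HOL-Complex_Analysis.Complex_Analysis"
begin

text \<open>
  \<open>M\<^sub>n\<close> is the type \<open>complex^'n^'n\<close> acting on the Hilbert space \<open>complex^'n\<close>. The rows and
  columns are numbered \<open>1, \<dots>, n\<close> by a bijection \<open>ix\<close> from \<open>'n\<close> to \<open>{1..n}\<close>, which is a
  parameter. The product of matrices is \<open>**\<close>; the type class multiplication on \<open>'a^'n\<close> is
  componentwise and is not used.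
\<close>

definition cscale :: "complex \<Rightarrow> complex^'n^'n \<Rightarrow> complex^'n^'n" where
  "cscale c A = map_matrix ((*) c) A"

definition opnorm :: "complex^'n^'n \<Rightarrow> real" where
  "opnorm A = onorm (\<lambda>v. A *v v)"

definition disk_algebra :: "(complex \<Rightarrow> complex) set" where
  "disk_algebra = {f. continuous_on (cball 0 1) f \<and> f holomorphic_on ball 0 1}"

definition ell :: "nat \<Rightarrow> nat \<Rightarrow> nat \<Rightarrow> nat" where
  "ell n i j = nat ((int j - int i) mod int n)"

text \<open>
  Matrix-valued functions on the closed disk are represented by functions on the whole plane
  that vanish outside the closed disk, so that equality of elements is equality on the closed disk.
\<close>

definition cycle_matrix ::
    "nat \<Rightarrow> ('n::finite \<Rightarrow> nat) \<Rightarrow> ('n \<Rightarrow> 'n \<Rightarrow> complex \<Rightarrow> complex) \<Rightarrow> complex \<Rightarrow> complex^'n^'n" where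
  "cycle_matrix n ix f z =
     (if z \<in> cball 0 1 then \<chi> i j. z ^ ell n (ix i) (ix j) * f i j (z ^ n) else 0)"

definition cycle_algebra :: "nat \<Rightarrow> ('n::finite \<Rightarrow> nat) \<Rightarrow> (complex \<Rightarrow> complex^'n^'n) set" where
  "cycle_algebra n ix = {cycle_matrix n ix f | f. \<forall>i j. f i j \<in> disk_algebra}"

definition disk_norm :: "(complex \<Rightarrow> complex^'n^'n) \<Rightarrow> real" where
  "disk_norm F = (SUP z\<in>cball 0 1. opnorm (F z))"

text \<open>
  Replacing \<open>z\<close> by \<open>\<lambda>\<close> in \<open>[z\<^bsup>\<ell>(i,j)\<^esup> f\<^sub>i\<^sub>j(z\<^sup>n)]\<close> is evaluation at \<open>\<lambda>\<close>; the lemma below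
  spells this out.
\<close>

definition phi :: "complex \<Rightarrow> (complex \<Rightarrow> complex^'n^'n) \<Rightarrow> complex^'n^'n" where
  "phi l F = F l"

lemma phi_cycle_matrix:
  assumes "cmod l \<le> 1"
  shows "phi l (cycle_matrix n ix f) = (\<chi> i j. l ^ ell n (ix i) (ix j) * f i j (l ^ n))"
  using assms by (simp add: phi_def cycle_matrix_def)

text \<open>
  In the next two definitions \<open>A\<close> is an algebra of matrix-valued functions on the closed disk with
  the norm \<open>disk_norm\<close>, and \<open>\<pi>\<close> is a representation of \<open>A\<close> on \<open>complex^'n\<close>. Only the values of
  \<open>D\<close> on \<open>A\<close> matter.
\<close>

definition point_derivation ::
    "(complex \<Rightarrow> complex^'n^'n) set \<Rightarrow> ((complex \<Rightarrow> complex^'n^'n) \<Rightarrow> complex^'n^'n) \<Rightarrow>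
     ((complex \<Rightarrow> complex^'n^'n) \<Rightarrow> complex^'n^'n) \<Rightarrow> bool" where
  "point_derivation A \<pi> D \<longleftrightarrow>
     (\<forall>F\<in>A. \<forall>G\<in>A. D (\<lambda>z. F z + G z) = D F + D G) \<and>
     (\<forall>c. \<forall>F\<in>A. D (\<lambda>z. cscale c (F z)) = cscale c (D F)) \<and>
     (\<forall>F\<in>A. \<forall>\<epsilon>>0. \<exists>\<delta>>0. \<forall>G\<in>A.
        disk_norm (\<lambda>z. G z - F z) < \<delta> \<longrightarrow> opnorm (D G - D F) < \<epsilon>) \<and>
     (\<forall>F\<in>A. \<forall>G\<in>A. D (\<lambda>z. F z ** G z) = D F ** \<pi> G + \<pi> F ** D G)"

definition inner_at ::
    "(complex \<Rightarrow> complex^'n^'n) set \<Rightarrow> ((complex \<Rightarrow> complex^'n^'n) \<Rightarrow> complex^'n^'n) \<Rightarrow>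
     ((complex \<Rightarrow> complex^'n^'n) \<Rightarrow> complex^'n^'n) \<Rightarrow> bool" where
  "inner_at A \<pi> D \<longleftrightarrow> (\<exists>X. \<forall>F\<in>A. D F = \<pi> F ** X - X ** \<pi> F)"

end

theory Submission
  imports Defs
begin

text \<open>
  Entrywise differentiation at \<open>l\<close> is a derivation at \<open>phi l\<close>, continuous by Cauchy's inequality.
  An inner derivation kills every \<open>F\<close> for which \<open>F l\<close> is central. For \<open>l \<noteq> 0\<close> (or \<open>n = 1\<close>) the
  scalar function \<open>z\<^sup>n\<close> is such an element with derivative \<open>n l\<^bsup>n-1\<^esup> \<noteq> 0\<close>; for \<open>l = 0\<close> and
  \<open>n \<ge> 2\<close> so is \<open>z\<close> times the cyclic shift.
\<close>

no_notation fps_nth (infixl \<open>$\<close> 75)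

lemma norm_matrix_vector_le_sum_entries:
  fixes A :: "complex^'n^'n"
  shows "norm (A *v v) \<le> (\<Sum>i\<in>UNIV. \<Sum>j\<in>UNIV. norm (A$i$j)) * norm v"
proof -
  have "norm (A *v v) \<le> (\<Sum>i\<in>UNIV. norm ((A *v v)$i))"
    unfolding norm_vec_def by (rule L2_set_le_sum) simp
  also have "\<dots> \<le> (\<Sum>i\<in>UNIV. \<Sum>j\<in>UNIV. norm (A$i$j) * norm v)"
  proof (rule sum_mono)
    fix i
    have "norm ((A *v v)$i) \<le> (\<Sum>j\<in>UNIV. norm (A$i$j * v$j))"
      unfolding matrix_vector_mult_def vec_lambda_beta by (rule norm_sum)
    also have "\<dots> \<le> (\<Sum>j\<in>UNIV. norm (A$i$j) * norm v)"
      by (intro sum_mono) (simp add: norm_mult mult_left_mono Finite_Cartesian_Product.norm_nth_le)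
    finally show "norm ((A *v v)$i) \<le> (\<Sum>j\<in>UNIV. norm (A$i$j) * norm v)" .
  qed
  finally show ?thesis by (simp add: sum_distrib_right)
qed

text \<open>With \<open>norm_entry_le_opnorm\<close> this makes \<open>opnorm\<close> and the
  entrywise size equivalent, so continuity can be checked entry by entry. The crude constant is
  enough for that.\<close>

lemma opnorm_le_sum_entries: "opnorm A \<le> (\<Sum>i\<in>UNIV. \<Sum>j\<in>UNIV. norm (A$i$j))"
  unfolding opnorm_def by (rule onorm_le) (rule norm_matrix_vector_le_sum_entries)

text \<open>An entry is a coordinate of the image of a standard basis vector, which has norm
  1.\<close>

lemma norm_entry_le_opnorm:
  fixes A :: "complex^'n^'n"
  shows "norm (A$i$j) \<le> opnorm A"
proof -
  have "A$i$j = (A *v axis j 1)$i"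
    by (simp add: matrix_vector_mult_def axis_def if_distrib cong: if_cong)
  then have "norm (A$i$j) \<le> norm (A *v axis j 1)"
    by (metis Finite_Cartesian_Product.norm_nth_le)
  also have "\<dots> \<le> opnorm A * norm (axis j 1 :: complex^'n)"
    unfolding opnorm_def by (rule onorm[OF matrix_vector_mul_bounded_linear])
  also have "norm (axis j 1 :: complex^'n) = 1"
    by (simp add: norm_vec_def L2_set_def axis_def if_distrib[of norm] if_distrib[of "\<lambda>x. x\<^sup>2"]
        cong: if_cong)
  finally show ?thesis by simp
qed

text \<open>The real supremum in \<open>disk_norm\<close> dominates the values only if these are
  bounded above. Continuity of the entries on the compact disk supplies the bound, through the sum
  of the absolute values of the entries.\<close>

lemma norm_entry_le_disk_norm:
  fixes F :: "complex \<Rightarrow> complex^'n^'n"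
  assumes "\<And>i j. continuous_on (cball 0 1) (\<lambda>z. F z $ i $ j)" and "z \<in> cball 0 1"
  shows "norm (F z $ i $ j) \<le> disk_norm F"
proof -
  let ?s = "\<lambda>z. \<Sum>i\<in>UNIV. \<Sum>j\<in>UNIV. norm (F z $ i $ j)"
  have "continuous_on (cball 0 1) ?s"
    by (intro continuous_intros assms)
  then have "bdd_above (?s ` cball 0 1)"
    by (intro bounded_imp_bdd_above compact_imp_bounded compact_continuous_image) auto
  then obtain M where M: "\<And>w. w \<in> cball 0 1 \<Longrightarrow> ?s w \<le> M"
    unfolding bdd_above_def by blast
  have "bdd_above ((\<lambda>w. opnorm (F w)) ` cball 0 1)"
    by (rule bdd_aboveI2[of _ _ M]) (use M opnorm_le_sum_entries order_trans in blast)
  then have "opnorm (F z) \<le> disk_norm F"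
    unfolding disk_norm_def using assms(2) by (rule cSUP_upper2[OF _ _ order_refl])
  then show ?thesis
    using norm_entry_le_opnorm order_trans by blast
qed

text \<open>All that the derivation property needs to know about the algebra. Its cyclic structure
  matters only for the witnesses against innerness.\<close>

lemma cycle_algebra_entry:
  assumes "n \<ge> 1" and "F \<in> cycle_algebra n ix"
  shows "continuous_on (cball 0 1) (\<lambda>z. F z $ i $ j)"
    and "(\<lambda>z. F z $ i $ j) holomorphic_on ball 0 1"
proof -
  obtain f where F: "F = cycle_matrix n ix f" and f: "\<And>i j. f i j \<in> disk_algebra"
    using assms(2) by (auto simp: cycle_algebra_def)
  let ?g = "\<lambda>z. z ^ ell n (ix i) (ix j) * f i j (z ^ n)"
  have eq: "F z $ i $ j = ?g z" if "z \<in> cball 0 1" for z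
    using that by (simp add: F cycle_matrix_def)
  have "continuous_on (cball 0 1) (\<lambda>z. f i j (z ^ n))"
  proof (rule continuous_on_compose2[of "cball 0 1" "f i j" _ "\<lambda>z. z ^ n"])
    show "continuous_on (cball 0 1) (f i j)"
      using f[of i j] by (simp add: disk_algebra_def)
    show "(\<lambda>z. z ^ n) ` cball 0 1 \<subseteq> cball (0::complex) 1"
      by (auto simp: norm_power power_le_one)
  qed (intro continuous_intros)
  then have "continuous_on (cball 0 1) ?g"
    by (intro continuous_intros)
  then show "continuous_on (cball 0 1) (\<lambda>z. F z $ i $ j)"
    by (rule continuous_on_eq) (simp add: eq)
  \<comment> \<open>Here \<open>n \<ge> 1\<close> enters: the power \<open>z ^ 0 = 1\<close> would
    lie on the unit circle, where \<open>f i j\<close> need not be holomorphic.\<close>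
  have "(\<lambda>z::complex. z ^ n) ` ball 0 1 \<subseteq> ball 0 1"
    using assms(1) by (auto simp: norm_power power_less_one_iff)
  then have "(f i j \<circ> (\<lambda>z. z ^ n)) holomorphic_on ball 0 1"
    using f[of i j]
    by (intro holomorphic_on_compose_gen[of "\<lambda>z. z ^ n" _ "f i j"] holomorphic_intros)
      (auto simp: disk_algebra_def)
  then have "?g holomorphic_on ball 0 1"
    unfolding o_def by (intro holomorphic_intros)
  then show "(\<lambda>z. F z $ i $ j) holomorphic_on ball 0 1"
    by (rule holomorphic_transform) (simp add: eq)
qed

definition matrix_deriv :: "complex \<Rightarrow> (complex \<Rightarrow> complex^'n^'n) \<Rightarrow> complex^'n^'n" where
  "matrix_deriv l F = (\<chi> i j. deriv (\<lambda>z. F z $ i $ j) l)"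

text \<open>Cauchy's inequality on the largest disk around \<open>l\<close> inside the unit disk.
  Its boundary touches the unit circle, so the entries have to be continuous and bounded up to
  there.\<close>

lemma norm_deriv_entry_le_disk_norm:
  fixes F :: "complex \<Rightarrow> complex^'n^'n"
  assumes "\<And>i j. continuous_on (cball 0 1) (\<lambda>z. F z $ i $ j)"
    and "\<And>i j. (\<lambda>z. F z $ i $ j) holomorphic_on ball 0 1"
    and "cmod l < 1"
  shows "norm (deriv (\<lambda>z. F z $ i $ j) l) \<le> disk_norm F / (1 - cmod l)"
proof -
  have sub: "cball l (1 - cmod l) \<subseteq> cball 0 1" "ball l (1 - cmod l) \<subseteq> ball 0 1"
    by (auto simp: cball_subset_cball_iff ball_subset_ball_iff dist_norm)
  have "norm ((deriv ^^ 1) (\<lambda>z. F z $ i $ j) l) \<le> fact 1 * disk_norm F / (1 - cmod l) ^ 1"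
  proof (rule Cauchy_inequality)
    show "norm (F z $ i $ j) \<le> disk_norm F" if "norm (l - z) = 1 - cmod l" for z
    proof (intro norm_entry_le_disk_norm assms(1))
      have "z \<in> cball l (1 - cmod l)"
        using that by (simp add: dist_norm)
      then show "z \<in> cball 0 1"
        using sub by blast
    qed
    show "(\<lambda>z. F z $ i $ j) holomorphic_on ball l (1 - cmod l)"
      using assms(2) sub(2) by (rule holomorphic_on_subset)
    show "continuous_on (cball l (1 - cmod l)) (\<lambda>z. F z $ i $ j)"
      using assms(1) sub(1) by (rule continuous_on_subset)
  qed (use assms(3) in simp)
  then show ?thesis by simp
qed

lemma point_derivation_matrix_deriv:
  fixes ix :: "'n::finite \<Rightarrow> nat"
  assumes n: "n \<ge> 1" and l: "cmod l < 1"
  shows "point_derivation (cycle_algebra n ix) (phi l) (matrix_deriv l)"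
proof -
  let ?A = "cycle_algebra n ix"
  have d: "(\<lambda>z. F z $ i $ j) field_differentiable at l" if "F \<in> ?A" for F i j
    using cycle_algebra_entry(2)[OF n that] l
    by (metis holomorphic_on_imp_differentiable_at mem_ball_0 open_ball)
  \<comment> \<open>By linearity, continuity at \<open>F\<close> reduces to a bound on the
    derivative of a difference.\<close>
  have diff: "matrix_deriv l G - matrix_deriv l F = matrix_deriv l (\<lambda>z. G z - F z)"
    if "F \<in> ?A" "G \<in> ?A" for F G
    using that by (simp add: vec_eq_iff matrix_deriv_def d)
  have cont: "\<exists>\<delta>>0. \<forall>G\<in>?A. disk_norm (\<lambda>z. G z - F z) < \<delta> \<longrightarrow>
      opnorm (matrix_deriv l G - matrix_deriv l F) < \<epsilon>" if F: "F \<in> ?A" and "\<epsilon> > 0" for F \<epsilon>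
  proof -
    \<comment> \<open>A Lipschitz constant: the Cauchy factor \<open>1 / (1 - cmod l)\<close> for
      each entry, times the number of entries.\<close>
    define K where "K = real CARD('n) * real CARD('n) / (1 - cmod l)"
    have K: "K > 0" using l by (simp add: K_def)
    have "opnorm (matrix_deriv l G - matrix_deriv l F) < \<epsilon>"
      if G: "G \<in> ?A" and small: "disk_norm (\<lambda>z. G z - F z) < \<epsilon> / K" for G
    proof -
      let ?H = "\<lambda>z. G z - F z"
      have "norm (matrix_deriv l ?H $ i $ j) \<le> disk_norm ?H / (1 - cmod l)" for i j
        using cycle_algebra_entry[OF n F] cycle_algebra_entry[OF n G] l
        unfolding matrix_deriv_def vec_lambda_beta
        by (intro norm_deriv_entry_le_disk_norm)
          (simp_all add: continuous_on_diff holomorphic_on_diff)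
      then have "(\<Sum>i\<in>UNIV. \<Sum>j\<in>UNIV. norm (matrix_deriv l ?H $ i $ j))
          \<le> (\<Sum>i\<in>(UNIV::'n set). \<Sum>j\<in>(UNIV::'n set). disk_norm ?H / (1 - cmod l))"
        by (intro sum_mono)
      also have "\<dots> = disk_norm ?H * K"
        by (simp add: K_def)
      also have "\<dots> < \<epsilon>"
        using small K by (simp add: pos_less_divide_eq)
      finally show ?thesis
        using opnorm_le_sum_entries[of "matrix_deriv l ?H"] diff[OF F G] by simp
    qed
    then show ?thesis
      using K \<open>\<epsilon> > 0\<close> by (intro exI[of _ "\<epsilon> / K"]) simp
  qed
  have mult: "matrix_deriv l (\<lambda>z. F z ** G z) =
      matrix_deriv l F ** phi l G + phi l F ** matrix_deriv l G" if "F \<in> ?A" "G \<in> ?A" for F G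
  proof -
    \<comment> \<open>The scalar product rule in each summand; as \<open>phi l\<close> is evaluation
      at \<open>l\<close>, the two groups of terms are the two matrix products.\<close>
    have "deriv (\<lambda>z. \<Sum>k\<in>UNIV. F z $ i $ k * G z $ k $ j) l =
      (\<Sum>k\<in>UNIV. deriv (\<lambda>z. F z $ i $ k) l * G l $ k $ j + F l $ i $ k * deriv (\<lambda>z. G z $ k $ j) l)"
      for i j
      using that by (simp add: deriv_sum d field_differentiable_mult add.commute)
    then show ?thesis
      by (simp add: vec_eq_iff matrix_deriv_def phi_def matrix_matrix_mult_def sum.distrib)
  qed
  have "matrix_deriv l (\<lambda>z. F z + G z) = matrix_deriv l F + matrix_deriv l G"
    if "F \<in> ?A" "G \<in> ?A" for F G
    using that by (simp add: vec_eq_iff matrix_deriv_def d)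
  moreover have "matrix_deriv l (\<lambda>z. cscale c (F z)) = cscale c (matrix_deriv l F)"
    if "F \<in> ?A" for F c
    using that by (simp add: vec_eq_iff matrix_deriv_def cscale_def map_matrix_def d)
  ultimately show ?thesis
    using cont mult by (simp add: point_derivation_def)
qed

text \<open>The cut-off to 0 outside the closed disk is invisible to a derivative at an interior
  point, so the formula for the entry may be differentiated instead.\<close>

lemma matrix_deriv_cycle_matrix:
  assumes "cmod l < 1"
    and "((\<lambda>z. z ^ ell n (ix i) (ix j) * f i j (z ^ n)) has_field_derivative c) (at l)"
  shows "matrix_deriv l (cycle_matrix n ix f) $ i $ j = c"
proof -
  have "((\<lambda>z. cycle_matrix n ix f z $ i $ j) has_field_derivative c) (at l)"
    by (rule has_field_derivative_transform_within_open[OF assms(2) open_ball[of 0 1]])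
      (use assms(1) in \<open>auto simp: cycle_matrix_def\<close>)
  then show ?thesis
    by (simp add: matrix_deriv_def DERIV_imp_deriv)
qed

lemma not_inner_at_matrix_deriv:
  fixes ix :: "'n::finite \<Rightarrow> nat"
  assumes "n \<ge> 1" and "bij_betw ix UNIV {1..n}" and "cmod l < 1"
  shows "\<not> inner_at (cycle_algebra n ix) (phi l) (matrix_deriv l)"
proof
  assume "inner_at (cycle_algebra n ix) (phi l) (matrix_deriv l)"
  then obtain X where X:
    "\<And>F. F \<in> cycle_algebra n ix \<Longrightarrow> matrix_deriv l F = phi l F ** X - X ** phi l F"
    by (auto simp: inner_at_def)
  show False
  \<comment> \<open>The split is on the derivative of \<open>z ^ n\<close> at \<open>l\<close>. For
    \<open>n = 1\<close> it is 1 even at \<open>l = 0\<close>, because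
    \<open>0 ^ 0 = 1\<close>.\<close>
  proof (cases "of_nat n * l ^ (n - 1) = 0")
    case False
    \<comment> \<open>\<open>cycle_matrix\<close> substitutes \<open>z ^ n\<close> into its
      coefficients and \<open>ell\<close> is 0 on the diagonal, so the identity function there
      produces the scalar matrix \<open>z ^ n\<close>.\<close>
    define f where "f = (\<lambda>i j. if i = (j::'n) then \<lambda>w. w else (\<lambda>w. 0::complex))"
    define F where "F = cycle_matrix n ix f"
    have "F \<in> cycle_algebra n ix"
      unfolding F_def cycle_algebra_def mem_Collect_eq
      by (intro exI[of _ f] conjI) (auto simp: f_def disk_algebra_def)
    moreover have "phi l F = mat (l ^ n)"
      using assms(3) by (auto simp: F_def phi_cycle_matrix f_def mat_def vec_eq_iff ell_def)
    moreover have "mat c ** X = X ** mat c" for c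
      by (simp add: vec_eq_iff matrix_matrix_mult_def mat_def mult.commute
          if_distrib[of "\<lambda>x. x * _"] if_distrib[of "\<lambda>x. _ * x"] cong: if_cong)
    ultimately have "matrix_deriv l F = 0"
      using X by simp
    moreover have "matrix_deriv l F $ i $ i = of_nat n * l ^ (n - 1)" for i
      unfolding F_def using assms(3)
      by (rule matrix_deriv_cycle_matrix)
        (auto simp: f_def ell_def intro!: derivative_eq_intros)
    ultimately show False
      using False by simp
  next
    case True
    then have l: "l = 0" and n: "n \<ge> 2"
      using assms(1) by (auto intro: ccontr)
    \<comment> \<open>A position with residue 1. For \<open>n = 1\<close> there would be none, as
      every residue is 0.\<close>
    obtain i j where ij: "ix i = 1" "ix j = 2"
      using assms(2) n unfolding bij_betw_def
      by (metis atLeastAtMost_iff imageE le_refl one_le_numeral order_trans)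
    \<comment> \<open>Constant coefficients at the positions of residue 1 give \<open>z\<close>
      times the cyclic shift. It vanishes at 0, yet its derivative there has entry 1 at
      \<open>i\<close>, \<open>j\<close>.\<close>
    define f where
      "f = (\<lambda>i j. if ell n (ix i) (ix j) = 1 then \<lambda>w::complex. 1 else (\<lambda>w. 0::complex))"
    define F where "F = cycle_matrix n ix f"
    have "F \<in> cycle_algebra n ix"
      unfolding F_def cycle_algebra_def mem_Collect_eq
      by (intro exI[of _ f] conjI) (auto simp: f_def disk_algebra_def)
    moreover have "phi l F = 0"
      using assms(3) l by (auto simp: F_def phi_cycle_matrix f_def vec_eq_iff)
    ultimately have "matrix_deriv l F = 0"
      using X by simp
    moreover have "ell n (ix i) (ix j) = 1"
      using ij n by (simp add: ell_def)
    then have "matrix_deriv l F $ i $ j = 1"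
      unfolding F_def using assms(3)
      by (intro matrix_deriv_cycle_matrix) (auto simp: f_def intro!: derivative_eq_intros)
    ultimately show False by simp
  qed
qed

theorem theorem2:
  fixes n :: nat and ix :: "'n::finite \<Rightarrow> nat" and l :: complex
  assumes "n \<ge> 1"
    and "bij_betw ix UNIV {1..n}"
    and "cmod l < 1"
  shows "\<exists>D. point_derivation (cycle_algebra n ix) (phi l) D \<and>
             \<not> inner_at (cycle_algebra n ix) (phi l) D"
  using point_derivation_matrix_deriv[OF assms(1,3)] not_inner_at_matrix_deriv[OF assms]
  by blast

end
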